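(* If $n, m \geq 2$, then $c_H(K_n \square K_m) \leq 4$.
   Context: $K_n$ is the complete graph on $n$ vertices. The Cartesian product $G \square J$ has vertex set $V(G) \times V(J)$, with $(x,y)$ adjacent to $(x',y')$ iff either $x = x'$ and $yy' \in E(J)$, or $y = y'$ and $xx' \in E(G)$. Hyperopic Cops and Robber on a graph $H$ (each vertex considered to carry a loop, so a player may stay put): the cops first occupy a multiset of vertices, then the robber chooses a vertex. In each round, each cop moves to an adjacent vertex or stays, then the robber moves to an adjacent vertex or stays. The robber always sees all cops. The cops see the robber's position except when the robber's vertex is adjacent to every vertex occupied by a cop, in which case the robber is invisible. The robber is captured when a cop occupies the robber's vertex. $c_H(H)$ is the minimum number of cops that can guarantee capture in finitely many moves. *)

theory Defs
  imports "Graph_Theory.Graph_Theory" "HOL-Library.Extended_Nat"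
begin

text \<open>
  Simple graphs are represented as in Graph_Theory, by symmetric loop-free digraphs whose arcs are
  pairs of vertices (\<open>pair_graph\<close>).
\<close>

definition cartesian_product ::
    "'a pair_pre_digraph \<Rightarrow> 'b pair_pre_digraph \<Rightarrow> ('a \<times> 'b) pair_pre_digraph" (infixl "\<box>" 70) where
  "G \<box> J = \<lparr> pverts = pverts G \<times> pverts J,
     parcs = {((x, y), (x', y')).
        (x = x' \<and> x \<in> pverts G \<and> (y, y') \<in> parcs J) \<or>
        (y = y' \<and> y \<in> pverts J \<and> (x, x') \<in> parcs G)} \<rparr>"

lemma pair_graph_cartesian_product:
  assumes "pair_graph G" "pair_graph J"
  shows "pair_graph (G \<box> J)"
proof -
  interpret G: pair_graph G by fact
  interpret J: pair_graph J by fact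
  have sub: "parcs (G \<box> J) \<subseteq> pverts (G \<box> J) \<times> pverts (G \<box> J)"
    by (auto simp: cartesian_product_def dest: G.wellformed' J.wellformed')
  have fin: "finite (pverts (G \<box> J))"
    by (simp add: cartesian_product_def G.pair_finite_verts J.pair_finite_verts)
  have "finite (parcs (G \<box> J))"
    using finite_subset[OF sub] fin by blast
  moreover have "sym (parcs (G \<box> J))"
    using G.pair_sym_arcs J.pair_sym_arcs
    by (auto simp: cartesian_product_def symmetric_def intro!: symI dest: symD)
  moreover have "fst e \<noteq> snd e" if "e \<in> parcs (G \<box> J)" for e
    using that G.pair_no_loops J.pair_no_loops by (fastforce simp: cartesian_product_def)
  ultimately show ?thesis
    using sub fin by unfold_locales (auto simp: symmetric_def)
qed

text \<open>
  Adjacency in the game on \<open>G\<close>: every vertex carries a loop, which allows a player to stay put.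
\<close>

definition game_adj :: "'a pair_pre_digraph \<Rightarrow> 'a \<Rightarrow> 'a \<Rightarrow> bool" where
  "game_adj G u v \<longleftrightarrow> u \<in> pverts G \<and> v \<in> pverts G \<and> (u = v \<or> (u, v) \<in> parcs G)"

text \<open>
  What the cops, standing on the vertices \<open>cs\<close>, see of a robber on \<open>r\<close>; \<open>None\<close> means that he is
  invisible. Using \<open>game_adj\<close> here instead of adjacency without loops makes a difference only if a
  cop is on \<open>r\<close>, and then the robber is already captured.
\<close>

definition sighting :: "'a pair_pre_digraph \<Rightarrow> 'a list \<Rightarrow> 'a \<Rightarrow> 'a option" where
  "sighting G cs r = (if \<forall>c \<in> set cs. game_adj G r c then None else Some r)"

text \<open>
  A strategy of the cops maps the list of all sightings made so far (oldest first) to the next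
  positions of the cops, the empty list being mapped to their initial positions. The cops' earlier
  positions need not be an argument, since they are determined by the strategy and the earlier
  sightings.
\<close>

type_synonym 'a cop_strategy = "'a option list \<Rightarrow> 'a list"

text \<open>
  \<open>sightings G S r t\<close> lists the sightings up to the end of round \<open>t\<close> when the cops follow \<open>S\<close> and the
  robber is on \<open>r 0\<close> after his initial choice and on \<open>r i\<close> after his move in round \<open>i\<close>. As
  visibility depends on the current positions at all times, the cops look twice in every round:
  after their own move and after the robber's move.
\<close>

primrec sightings ::
    "'a pair_pre_digraph \<Rightarrow> 'a cop_strategy \<Rightarrow> (nat \<Rightarrow> 'a) \<Rightarrow> nat \<Rightarrow> 'a option list" where
  "sightings G S r 0 = [sighting G (S []) (r 0)]"
| "sightings G S r (Suc t) =
     sightings G S r t @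
     [sighting G (S (sightings G S r t)) (r t), sighting G (S (sightings G S r t)) (r (Suc t))]"

primrec cops_at ::
    "'a pair_pre_digraph \<Rightarrow> 'a cop_strategy \<Rightarrow> (nat \<Rightarrow> 'a) \<Rightarrow> nat \<Rightarrow> 'a list" where
  "cops_at G S r 0 = S []"
| "cops_at G S r (Suc t) = S (sightings G S r t)"

definition robber_play :: "'a pair_pre_digraph \<Rightarrow> (nat \<Rightarrow> 'a) \<Rightarrow> bool" where
  "robber_play G r \<longleftrightarrow> (\<forall>t. r t \<in> pverts G \<and> game_adj G (r t) (r (Suc t)))"

definition legal_strategy :: "'a pair_pre_digraph \<Rightarrow> nat \<Rightarrow> 'a cop_strategy \<Rightarrow> bool" where
  "legal_strategy G k S \<longleftrightarrow>
     length (S []) = k \<and> set (S []) \<subseteq> pverts G \<and>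
     (\<forall>r. robber_play G r \<longrightarrow>
        (\<forall>t. list_all2 (game_adj G) (cops_at G S r t) (cops_at G S r (Suc t))))"

text \<open>
  The robber is captured if a cop is on his vertex after a move of the robber (first disjunct) or
  after a move of the cops (second disjunct).
\<close>

definition captured :: "'a pair_pre_digraph \<Rightarrow> 'a cop_strategy \<Rightarrow> (nat \<Rightarrow> 'a) \<Rightarrow> bool" where
  "captured G S r \<longleftrightarrow>
     (\<exists>t. r t \<in> set (cops_at G S r t) \<or> r t \<in> set (cops_at G S r (Suc t)))"

text \<open>
  The robber sees the cops, so his moves may depend on theirs. Against a fixed strategy \<open>S\<close> of the
  cops, the plays of such robbers are exactly all walks \<open>r\<close>, over which the following quantifies.
\<close>

definition cops_can_win :: "'a pair_pre_digraph \<Rightarrow> nat \<Rightarrow> bool" where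
  "cops_can_win G k \<longleftrightarrow>
     (\<exists>S. legal_strategy G k S \<and> (\<forall>r. robber_play G r \<longrightarrow> captured G S r))"

text \<open>The value is \<open>\<infinity>\<close> if no number of cops suffices.\<close>

definition hyperopic_cop_number :: "'a pair_pre_digraph \<Rightarrow> enat" (\<open>c\<^sub>H\<close>) where
  "c\<^sub>H G = Inf (enat ` {k. cops_can_win G k})"

end

(* Put the cops on the corners of a rectangle. The only vertices adjacent to two opposite corners are
   the other two corners, so the robber is visible unless he is captured. If no cop can capture him on
   (x, y) at once, one cop moves from (a, b) into his row, to (x, b), and another one from (c, d) into
   his column, to (c, y). Wherever he moves, he is then adjacent to one of these two, and the cop who
   stays on (c, b) keeps him visible. *)
theory Submission
  imports Defs
begin

text \<open>Any two distinct vertices of a complete graph are adjacent, so a move in the product is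
  a rook move: one coordinate is kept, the other is arbitrary.\<close>

lemma cartesian_product_complete_simps:
  assumes "K\<^bsub>n\<^esub> (with_proj G)" and "K\<^bsub>m\<^esub> (with_proj J)"
  shows pverts_cartesian_product: "pverts (G \<box> J) = pverts G \<times> pverts J"
    and game_adj_cartesian_product_complete:
      "game_adj (G \<box> J) (x, y) (x', y') \<longleftrightarrow>
        x \<in> pverts G \<and> y \<in> pverts J \<and> x' \<in> pverts G \<and> y' \<in> pverts J \<and> (x = x' \<or> y = y')"
  using assms by (auto simp: complete_digraph_def cartesian_product_def game_adj_def)

definition catch :: "'a pair_pre_digraph \<Rightarrow> 'a option \<Rightarrow> 'a list \<Rightarrow> 'a list" where
  "catch H s cs =
     (case s of None \<Rightarrow> cs | Some p \<Rightarrow> map (\<lambda>c. if game_adj H c p then p else c) cs)"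

lemma list_all2_catch:
  assumes "set cs \<subseteq> pverts H"
  shows "list_all2 (game_adj H) cs (catch H s cs)"
  using assms by (auto simp: catch_def game_adj_def list_all2_conv_all_nth split: option.split)

lemma mem_catch:
  assumes "c \<in> set cs" and "game_adj H c p"
  shows "p \<in> set (catch H (Some p) cs)"
  using assms by (force simp: catch_def)

text \<open>The order matters, since a list position identifies a cop: the first two, on opposite
  corners, are those whom \<open>approach\<close> sends out.\<close>

definition corners :: "'a \<Rightarrow> 'b \<Rightarrow> 'a \<Rightarrow> 'b \<Rightarrow> ('a \<times> 'b) list" where
  "corners a b c d = [(a, b), (c, d), (a, d), (c, b)]"

text \<open>Staying put on \<open>None\<close> is a default that keeps every move legal.\<close>

definition approach :: "('a \<times> 'b) pair_pre_digraph \<Rightarrow> 'a \<Rightarrow> 'b \<Rightarrow> 'a \<Rightarrow> 'b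
    \<Rightarrow> ('a \<times> 'b) option \<Rightarrow> ('a \<times> 'b) list" where
  "approach H a b c d s =
     (case s of
        None \<Rightarrow> corners a b c d
      | Some (x, y) \<Rightarrow>
          if \<exists>q \<in> set (corners a b c d). game_adj H q (x, y) then catch H s (corners a b c d)
          else [(x, b), (c, y), (a, d), (c, b)])"

text \<open>
  The sightings at indices 0 and 2 are those made after the robber's choice and after his first move;
  the one at index 1, made after the first move of the cops, is ignored.
\<close>

definition corner_strategy :: "('a \<times> 'b) pair_pre_digraph \<Rightarrow> 'a \<Rightarrow> 'b \<Rightarrow> 'a \<Rightarrow> 'b
    \<Rightarrow> ('a \<times> 'b) cop_strategy" where
  "corner_strategy H a b c d l =
     (if l = [] then corners a b c d
      else if length l < 3 then approach H a b c d (l ! 0)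
      else catch H (l ! 2) (approach H a b c d (l ! 0)))"

lemma length_sightings [simp]: "length (sightings H S r t) = Suc (2 * t)"
  by (induction t) auto

text \<open>Later rounds only append, so entries 0 and 2 can be evaluated in the shortest lists that
  contain them.\<close>

lemma nth_sightings_mono:
  assumes "i < Suc (2 * t)" and "t \<le> t'"
  shows "sightings H S r t' ! i = sightings H S r t ! i"
  using assms(2,1) by (induction rule: dec_induct) (auto simp: nth_append)

lemma sighting_in_pverts:
  "sighting H cs p = Some q \<Longrightarrow> p \<in> pverts H \<Longrightarrow> q \<in> pverts H"
  by (auto simp: sighting_def split: if_splits)

text \<open>The strategy reads only sightings 0 and 2, so its positions have closed forms,
  independent of \<open>t\<close> from round two on.\<close>

lemma cops_at_corner_strategy:
  fixes H :: "('a \<times> 'b) pair_pre_digraph"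
  defines "S \<equiv> corner_strategy H"
    and "A \<equiv> \<lambda>a b c d r. approach H a b c d (sighting H (corners a b c d) (r 0))"
  shows "cops_at H (S a b c d) r 0 = corners a b c d"
    and "cops_at H (S a b c d) r (Suc 0) = A a b c d r"
    and "cops_at H (S a b c d) r (Suc (Suc t)) =
      catch H (sighting H (A a b c d r) (r 1)) (A a b c d r)"
proof -
  show 0: "cops_at H (S a b c d) r 0 = corners a b c d"
    by (simp add: S_def corner_strategy_def)
  then show 1: "cops_at H (S a b c d) r (Suc 0) = A a b c d r"
    by (simp add: S_def A_def corner_strategy_def)
  let ?l = "sightings H (S a b c d) r (Suc t)"
  have "?l ! 0 = sighting H (corners a b c d) (r 0)"
    using nth_sightings_mono[of 0 0 "Suc t" H "S a b c d" r] 0 by simp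
  moreover have "?l ! 2 = sighting H (A a b c d r) (r 1)"
    using nth_sightings_mono[of 2 1 "Suc t" H "S a b c d" r] 1 by simp
  moreover have "?l \<noteq> []" "\<not> length ?l < 3"
    using length_sightings[of H "S a b c d" r "Suc t"] by auto
  ultimately show "cops_at H (S a b c d) r (Suc (Suc t)) =
      catch H (sighting H (A a b c d r) (r 1)) (A a b c d r)"
    unfolding cops_at.simps A_def S_def corner_strategy_def[of _ _ _ _ _ "sightings _ _ _ _"]
    by presburger
qed

context
  fixes G :: "'a pair_pre_digraph" and J :: "'b pair_pre_digraph" and n m :: nat and a b c d
  assumes G: "K\<^bsub>n\<^esub> (with_proj G)" and J: "K\<^bsub>m\<^esub> (with_proj J)"
    and a: "a \<in> pverts G" and c: "c \<in> pverts G" and ac: "a \<noteq> c"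
    and b: "b \<in> pverts J" and d: "d \<in> pverts J" and bd: "b \<noteq> d"
begin

lemmas rook_simps = cartesian_product_complete_simps[OF G J] a b c d

lemma corners_subset: "set (corners a b c d) \<subseteq> pverts (G \<box> J)"
  by (simp add: corners_def rook_simps)

text \<open>Each cop sent out keeps one coordinate: \<open>b\<close> on the way to
  \<open>(x, b)\<close>, \<open>c\<close> on the way to \<open>(c, y)\<close>.\<close>

lemma list_all2_approach:
  assumes "\<And>p. s = Some p \<Longrightarrow> p \<in> pverts (G \<box> J)"
  shows "list_all2 (game_adj (G \<box> J)) (corners a b c d) (approach (G \<box> J) a b c d s)"
proof (cases s)
  case None
  then show ?thesis
    by (simp add: approach_def corners_def rook_simps)
next
  case (Some p)
  then show ?thesis
    using assms list_all2_catch[OF corners_subset, of s]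
    by (cases p) (auto simp: approach_def corners_def rook_simps)
qed

lemma legal_corner_strategy:
  "legal_strategy (G \<box> J) 4 (corner_strategy (G \<box> J) a b c d)"
proof -
  let ?H = "G \<box> J"
  have "list_all2 (game_adj ?H) (cops_at ?H (corner_strategy ?H a b c d) r t)
      (cops_at ?H (corner_strategy ?H a b c d) r (Suc t))"
    if "robber_play ?H r" for r t
  proof -
    define A where "A = approach ?H a b c d (sighting ?H (corners a b c d) (r 0))"
    have legal1: "list_all2 (game_adj ?H) (corners a b c d) A"
      unfolding A_def using that
      by (intro list_all2_approach) (auto simp: robber_play_def dest: sighting_in_pverts)
    have stay: "list_all2 (game_adj ?H) cs cs" if "set cs \<subseteq> pverts ?H" for cs
      using list_all2_catch[OF that, of None] by (simp add: catch_def)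
    have subset: "set cs' \<subseteq> pverts ?H" if "list_all2 (game_adj ?H) cs cs'" for cs cs'
      using that by (induction rule: list_all2_induct) (auto simp: game_adj_def)
    note legal2 = list_all2_catch[OF subset[OF legal1]]
    \<comment> \<open>Positions can change only in rounds one and two, that is for
      \<open>t = 0\<close> and \<open>t = 1\<close>; afterwards all cops stay.\<close>
    consider "t = 0" | "t = 1" | t' where "t = Suc (Suc t')"
      by (metis One_nat_def not0_implies_Suc)
    then show ?thesis
      by cases (simp_all only: cops_at_corner_strategy One_nat_def legal1 legal2
          stay[OF subset[OF legal2]] flip: A_def)
  qed
  then show ?thesis
    using corners_subset
    by (simp add: legal_strategy_def del: cops_at.simps)
       (simp add: corner_strategy_def corners_def)
qed

lemma captured_corner_strategy:
  assumes "robber_play (G \<box> J) r"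
  shows "captured (G \<box> J) (corner_strategy (G \<box> J) a b c d) r"
proof (rule ccontr)
  let ?H = "G \<box> J"
  assume "\<not> ?thesis"
  then have free: "r t \<notin> set (cops_at ?H (corner_strategy ?H a b c d) r t)"
    "r t \<notin> set (cops_at ?H (corner_strategy ?H a b c d) r (Suc t))" for t
    unfolding captured_def by blast+
  obtain x y x' y' where r: "r 0 = (x, y)" "r 1 = (x', y')"
    by fastforce
  have adj: "game_adj ?H (x, y) (x', y')"
    using assms r by (auto simp: robber_play_def dest: spec[of _ 0])
  have free0: "(x, y) \<notin> set (corners a b c d)"
    using free(1)[of 0] r by (simp add: cops_at_corner_strategy del: cops_at.simps)
  with adj have seen0: "sighting ?H (corners a b c d) (x, y) = Some (x, y)"
    using ac bd by (auto simp: sighting_def corners_def rook_simps)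
  define A where "A = approach ?H a b c d (Some (x, y))"
  have free1: "(x, y) \<notin> set A" "(x', y') \<notin> set A"
    using free(2)[of 0] free(1)[of 1] r seen0
    by (simp_all add: cops_at_corner_strategy A_def del: cops_at.simps)
  have free2: "(x', y') \<notin> set (catch ?H (sighting ?H A (x', y')) A)"
    using free(2)[of 1] r seen0
    by (simp add: cops_at_corner_strategy A_def del: cops_at.simps)
  \<comment> \<open>Otherwise \<open>approach\<close> would choose \<open>catch\<close> and put a
    cop on \<open>(x, y)\<close>, against \<open>free1\<close>.\<close>
  have far: "\<not> game_adj ?H q (x, y)" if "q \<in> set (corners a b c d)" for q
    using free1(1) that mem_catch[OF that] by (auto simp: A_def approach_def split: if_splits)
  then have A: "A = [(x, b), (c, y), (a, d), (c, b)]"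
    by (auto simp: A_def approach_def)
  have "x \<noteq> c" "y \<noteq> b"
    using far[of "(c, b)"] adj by (auto simp: corners_def rook_simps)
  \<comment> \<open>To be adjacent to \<open>(c, b)\<close>, the robber needs \<open>x' = c\<close>
    or \<open>y' = b\<close>. As he keeps \<open>x\<close> or \<open>y\<close>, he would then be on
    \<open>(c, y)\<close> or \<open>(x, b)\<close>, both occupied.\<close>
  with adj free1(2) have "sighting ?H A (x', y') = Some (x', y')"
    by (auto simp: A sighting_def rook_simps)
  moreover have "\<exists>q \<in> set A. game_adj ?H q (x', y')"
    using adj by (auto simp: A rook_simps)
  ultimately show False
    using free2 mem_catch by metis
qed

end

theorem theorem5p2:
  fixes n m :: nat
    and G :: "'a pair_pre_digraph" and J :: "'b pair_pre_digraph"
  assumes "n \<ge> 2" and "m \<ge> 2"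
    and "K\<^bsub>n\<^esub> (with_proj G)" and "K\<^bsub>m\<^esub> (with_proj J)"
  shows "c\<^sub>H (G \<box> J) \<le> 4"
proof -
  have two: "\<exists>u v. u \<in> pverts F \<and> v \<in> pverts F \<and> u \<noteq> v"
    if "K\<^bsub>k\<^esub> (with_proj F)" "k \<ge> 2" for k and F :: "'c pair_pre_digraph"
    \<comment> \<open>\<open>card\<close> is 0 on infinite sets, so a value of at least 2 gives the
      finiteness that \<open>card_le_Suc0_iff_eq\<close> requires.\<close>
    using that card_le_Suc0_iff_eq[of "pverts F"] card.infinite[of "pverts F"]
    by (fastforce simp: complete_digraph_def)
  obtain a c where "a \<in> pverts G" "c \<in> pverts G" "a \<noteq> c"
    using two[OF assms(3,1)] by blast
  moreover obtain b d where "b \<in> pverts J" "d \<in> pverts J" "b \<noteq> d"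
    using two[OF assms(4,2)] by blast
  ultimately have "cops_can_win (G \<box> J) 4"
    using legal_corner_strategy captured_corner_strategy assms(3,4)
    unfolding cops_can_win_def by metis
  then have "c\<^sub>H (G \<box> J) \<le> enat 4"
    unfolding hyperopic_cop_number_def by (intro Inf_lower) simp
  then show ?thesis
    by (simp add: numeral_eq_enat)
qed

end
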